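(* Let $f:\{0,1\}^n\to\{0,1\}$ admit the block property. Then $\mathrm{bs}_0(f)\le 4\,\mathrm{s}(f)^2$. In particular, if $f$ admits the normalized block property, then $\mathrm{bs}(f)\le 4\,\mathrm{s}(f)^2$.
   Context: For $x\in\{0,1\}^n$, $x^i$ is $x$ with bit $i$ flipped and $x^B$ is $x$ with bits in $B\subseteq[n]$ flipped. $\mathrm{s}(f,x)=|\{i: f(x)\ne f(x^i)\}|$, $\mathrm{s}(f)=\max_x\mathrm{s}(f,x)$. $\mathrm{bs}(f,x)$ is the maximum $k$ such that there are pairwise disjoint $B_1,\dots,B_k\subseteq[n]$ with $f(x^{B_j})\ne f(x)$ for all $j$; $\mathrm{bs}(f)=\max_x\mathrm{bs}(f,x)$, $\mathrm{bs}_0(f)=\max_{x:f(x)=0}\mathrm{bs}(f,x)$. A DNF representation of $f$ is an OR of terms $\wedge_1,\dots,\wedge_{d_\vee}$, each an AND of literals with no term containing a variable and its negation; $A_i$ (resp. $\overline{A}_i$) is the set of variables appearing unnegated (resp. negated) in $\wedge_i$, and $S_i$ is the set of assignments satisfying $\wedge_i$. It is in compact form if (a) $f(0^n)=0$, (b) $\mathrm{bs}_0(f)=\mathrm{bs}(f,0^n)$, (c) for each $i$, $S_i\setminus\bigcup_{j\neq i}S_j\ne\emptyset$; it is normalized if also $\mathrm{bs}(f)=\mathrm{bs}(f,0^n)$. $f$ admits the block property if it has a compact form DNF representation with $A_i\cap A_j=\emptyset$ for all $i\ne j$, and the normalized block property if such a representation can be chosen normalized. *)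

theory Defs
  imports "HOL-Library.Disjoint_Sets" "HOL-Library.Cardinality"
begin

text \<open>
  The cube \<open>{0,1}\<^sup>n\<close> is the function type \<open>'n \<Rightarrow> bool\<close> over a finite index type with
  \<open>CARD('n) = n\<close>; \<open>True\<close> is 1 and \<open>False\<close> is 0.
\<close>

type_synonym 'n assignment = "'n \<Rightarrow> bool"
type_synonym 'n boolfun = "'n assignment \<Rightarrow> bool"

definition zero_assignment :: "'n assignment" where
  "zero_assignment = (\<lambda>_. False)"

definition flip :: "'n assignment \<Rightarrow> 'n set \<Rightarrow> 'n assignment" where
  "flip x B = (\<lambda>i. if i \<in> B then \<not> x i else x i)"

definition sens_at :: "'n::finite boolfun \<Rightarrow> 'n assignment \<Rightarrow> nat" where
  "sens_at f x = card {i. f x \<noteq> f (flip x {i})}"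

definition sens :: "'n::finite boolfun \<Rightarrow> nat" where
  "sens f = Max (range (sens_at f))"

definition sensitive_blocks :: "'n boolfun \<Rightarrow> 'n assignment \<Rightarrow> nat \<Rightarrow> (nat \<Rightarrow> 'n set) \<Rightarrow> bool" where
  "sensitive_blocks f x k B \<longleftrightarrow>
     disjoint_family_on B {..<k} \<and> (\<forall>j<k. f (flip x (B j)) \<noteq> f x)"

definition bs_at :: "'n::finite boolfun \<Rightarrow> 'n assignment \<Rightarrow> nat" where
  "bs_at f x = Max {k. \<exists>B. sensitive_blocks f x k B}"

definition bs :: "'n::finite boolfun \<Rightarrow> nat" where
  "bs f = Max (range (bs_at f))"

text \<open>Unspecified (maximum of the empty set) if \<open>f\<close> is constantly 1.\<close>

definition bs0 :: "'n::finite boolfun \<Rightarrow> nat" where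
  "bs0 f = Max (bs_at f ` {x. \<not> f x})"

text \<open>The set whose maximum defines \<^const>\<open>bs_at\<close> is finite and nonempty.\<close>

lemma sensitive_blocks_le_card:
  fixes f :: "'n::finite boolfun"
  assumes "sensitive_blocks f x k B"
  shows "k \<le> CARD('n)"
proof -
  have ne: "B j \<noteq> {}" if "j < k" for j
    using assms that by (auto simp: sensitive_blocks_def flip_def)
  define g where "g j = (SOME i. i \<in> B j)" for j
  have g: "g j \<in> B j" if "j < k" for j
    using ne[OF that] by (auto simp: g_def intro: someI)
  have "inj_on g {..<k}"
  proof (rule inj_onI)
    fix i j assume "i \<in> {..<k}" "j \<in> {..<k}" "g i = g j"
    moreover from this have "g i \<in> B i \<inter> B j"
      using g[of i] g[of j] by auto
    ultimately show "i = j"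
      using assms unfolding sensitive_blocks_def disjoint_family_on_def by blast
  qed
  then have "card {..<k} \<le> CARD('n)"
    by (rule card_inj_on_le) auto
  then show ?thesis by simp
qed

lemma finite_sensitive_blocks:
  fixes f :: "'n::finite boolfun"
  shows "finite {k. \<exists>B. sensitive_blocks f x k B}"
  by (rule finite_subset[of _ "{..CARD('n)}"]) (auto dest: sensitive_blocks_le_card)

lemma sensitive_blocks_0: "sensitive_blocks f x 0 B"
  by (simp add: sensitive_blocks_def disjoint_family_on_def)

text \<open>
  A term is the pair \<open>(A, A')\<close> of the sets of its unnegated and its negated variables;
  a DNF is the list of its terms.
\<close>

type_synonym 'n dnf_term = "'n set \<times> 'n set"
type_synonym 'n dnf = "'n dnf_term list"

abbreviation pos_vars :: "'n dnf_term \<Rightarrow> 'n set" where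
  "pos_vars t \<equiv> fst t"

abbreviation neg_vars :: "'n dnf_term \<Rightarrow> 'n set" where
  "neg_vars t \<equiv> snd t"

definition sat_set :: "'n dnf_term \<Rightarrow> 'n assignment set" where
  "sat_set t = {x. (\<forall>i\<in>pos_vars t. x i) \<and> (\<forall>i\<in>neg_vars t. \<not> x i)}"

definition dnf_of :: "'n dnf \<Rightarrow> 'n boolfun \<Rightarrow> bool" where
  "dnf_of D f \<longleftrightarrow>
     (\<forall>t\<in>set D. pos_vars t \<inter> neg_vars t = {}) \<and>
     (\<forall>x. f x \<longleftrightarrow> (\<exists>t\<in>set D. x \<in> sat_set t))"

definition compact_dnf_of :: "'n::finite dnf \<Rightarrow> 'n boolfun \<Rightarrow> bool" where
  "compact_dnf_of D f \<longleftrightarrow>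
     dnf_of D f \<and>
     \<not> f zero_assignment \<and>
     bs0 f = bs_at f zero_assignment \<and>
     (\<forall>i<length D. sat_set (D ! i) - (\<Union>j\<in>{..<length D} - {i}. sat_set (D ! j)) \<noteq> {})"

definition normalized_dnf_of :: "'n::finite dnf \<Rightarrow> 'n boolfun \<Rightarrow> bool" where
  "normalized_dnf_of D f \<longleftrightarrow> compact_dnf_of D f \<and> bs f = bs_at f zero_assignment"

definition disjoint_pos_vars :: "'n dnf \<Rightarrow> bool" where
  "disjoint_pos_vars D \<longleftrightarrow>
     (\<forall>i<length D. \<forall>j<length D. i \<noteq> j \<longrightarrow> pos_vars (D ! i) \<inter> pos_vars (D ! j) = {})"

definition block_property :: "'n::finite boolfun \<Rightarrow> bool" where
  "block_property f \<longleftrightarrow> (\<exists>D. compact_dnf_of D f \<and> disjoint_pos_vars D)"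

definition normalized_block_property :: "'n::finite boolfun \<Rightarrow> bool" where
  "normalized_block_property f \<longleftrightarrow> (\<exists>D. normalized_dnf_of D f \<and> disjoint_pos_vars D)"

end

theory Submission
  imports Defs
begin

text \<open>
  Write \<open>A\<^sub>i\<close> for the unnegated and \<open>A'\<^sub>i\<close> for the negated variables of the \<open>i\<close>-th of \<open>d\<close> terms, and
  \<open>s\<close> for the sensitivity of \<open>f\<close>. Every sensitive block at \<open>0\<close> contains some \<open>A\<^sub>i\<close>, so
  \<open>bs(f,0) \<le> d\<close>, and it remains to bound \<open>d\<close>. The \<open>A\<^sub>i\<close> are nonempty and disjoint, so the indicator
  of \<open>A\<^sub>i\<close> satisfies only the term \<open>i\<close>, and flipping a variable of \<open>A'\<^sub>i \<inter> A\<^sub>j\<close> there falsifies \<open>f\<close>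
  unless \<open>A\<^sub>j\<close> is a singleton. Hence in the digraph with an edge \<open>i \<rightarrow> j\<close> whenever
  \<open>A'\<^sub>i \<inter> A\<^sub>j \<noteq> {}\<close> and \<open>A\<^sub>j\<close> is not a singleton, all out-degrees are at most \<open>s\<close>, and there is
  an independent set \<open>I\<close> with \<open>d \<le> (2s+1) |I|\<close>. Removing one element \<open>a\<^sub>i\<close> from each \<open>A\<^sub>i\<close>, \<open>i \<in> I\<close>,
  the indicator of the union of the remainders is a zero of \<open>f\<close> sensitive to every \<open>a\<^sub>i\<close>; so
  \<open>|I| \<le> s\<close> and \<open>d \<le> s (2s+1) \<le> 4s\<^sup>2\<close>.
\<close>

text \<open>Double counting of edges: in-degrees and out-degrees have the same sum, so the average
  in-degree is at most \<open>D\<close>.\<close>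

lemma exists_in_degree_le:
  assumes "finite V" "V \<noteq> {}" and deg: "\<And>i. i \<in> V \<Longrightarrow> card {j\<in>V. R i j} \<le> D"
  shows "\<exists>v\<in>V. card {i\<in>V. R i v} \<le> D"
proof (rule ccontr)
  assume "\<not> ?thesis"
  then have "(\<Sum>v\<in>V. D) < (\<Sum>v\<in>V. card {i\<in>V. R i v})"
    using assms(1,2) by (intro sum_strict_mono) auto
  also have "\<dots> = (\<Sum>i\<in>V. card {j\<in>V. R i j})"
    by (rule sum_multicount_gen[symmetric]) (use assms(1) in auto)
  also have "\<dots> \<le> (\<Sum>v\<in>V. D)"
    using deg by (rule sum_mono)
  finally show False by simp
qed

text \<open>Greedy choice: the out-degree bound passes to induced subgraphs, so each of them has a
  vertex with at most \<open>D\<close> in-neighbours and at most \<open>D\<close> out-neighbours.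
  Selecting it discards at most \<open>2 * D + 1\<close> vertices, itself included.\<close>

lemma exists_independent_set:
  assumes "finite V" and "\<And>i. i \<in> V \<Longrightarrow> card {j\<in>V. R i j} \<le> D"
  shows "\<exists>I\<subseteq>V. (\<forall>i\<in>I. \<forall>j\<in>I. i \<noteq> j \<longrightarrow> \<not> R i j) \<and> card V \<le> card I * (2 * D + 1)"
  using assms
proof (induction V rule: finite_psubset_induct)
  case (psubset V)
  show ?case
  proof (cases "V = {}")
    case False
    then obtain v where v: "v \<in> V" and inv: "card {i\<in>V. R i v} \<le> D"
      using exists_in_degree_le[of V R D] psubset by auto
    define X where "X = insert v ({i\<in>V. R i v} \<union> {j\<in>V. R v j})"
    have X: "X \<subseteq> V" "v \<in> X" using v by (auto simp: X_def)
    have "card X \<le> Suc (card ({i\<in>V. R i v} \<union> {j\<in>V. R v j}))"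
      unfolding X_def by (rule card_insert_le_m1) simp_all
    also have "\<dots> \<le> 2 * D + 1"
      using card_Un_le[of "{i\<in>V. R i v}" "{j\<in>V. R v j}"] inv psubset.prems[OF v] by linarith
    finally have cX: "card X \<le> 2 * D + 1" .
    have "card {j\<in>V - X. R i j} \<le> D" if "i \<in> V - X" for i
    proof -
      have "card {j\<in>V - X. R i j} \<le> card {j\<in>V. R i j}"
        by (rule card_mono) (use psubset.hyps in auto)
      with psubset.prems[of i] that show ?thesis by auto
    qed
    moreover have "V - X \<subset> V" using X v by blast
    ultimately obtain I where I: "I \<subseteq> V - X" "\<forall>i\<in>I. \<forall>j\<in>I. i \<noteq> j \<longrightarrow> \<not> R i j"
      "card (V - X) \<le> card I * (2 * D + 1)"
      using psubset.IH[of "V - X"] by blast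
    have "finite I" "v \<notin> I"
      using finite_subset[OF I(1)] I(1) X psubset.hyps by auto
    moreover have "card V \<le> card X + card (V - X)"
      using card_Un_le[of X "V - X"] X(1) by (simp add: Un_absorb1)
    ultimately have "card V \<le> card (insert v I) * (2 * D + 1)"
      using I(3) cX by simp
    moreover have "\<forall>i\<in>insert v I. \<forall>j\<in>insert v I. i \<noteq> j \<longrightarrow> \<not> R i j"
      using I(1,2) by (auto simp: X_def)
    moreover have "insert v I \<subseteq> V" using I(1) v by blast
    ultimately show ?thesis by blast
  qed simp
qed

lemma flip_indicator:
  "flip (\<lambda>k. k \<in> Y) B = (\<lambda>k. k \<in> (Y - B) \<union> (B - Y))"
  by (auto simp: flip_def)

lemma card_sensitive_le_sens:
  fixes f :: "'n::finite boolfun"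
  assumes "\<And>k. k \<in> K \<Longrightarrow> f x \<noteq> f (flip x {k})"
  shows "card K \<le> sens f"
proof -
  have "card K \<le> sens_at f x"
    unfolding sens_at_def using assms by (intro card_mono) auto
  also have "\<dots> \<le> sens f"
    unfolding sens_def by (rule Max_ge) auto
  finally show ?thesis .
qed

lemma dnf_of_indicator:
  assumes "dnf_of D f"
  shows "f (\<lambda>k. k \<in> Y) \<longleftrightarrow>
    (\<exists>i<length D. pos_vars (D ! i) \<subseteq> Y \<and> neg_vars (D ! i) \<inter> Y = {})"
proof -
  have "(\<lambda>k. k \<in> Y) \<in> sat_set t \<longleftrightarrow> pos_vars t \<subseteq> Y \<and> neg_vars t \<inter> Y = {}" for t
    unfolding sat_set_def by blast
  then show ?thesis
    using assms unfolding dnf_of_def by (metis in_set_conv_nth)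
qed

lemma pos_vars_nonempty:
  assumes "dnf_of D f" "\<not> f zero_assignment" "i < length D"
  shows "pos_vars (D ! i) \<noteq> {}"
  using dnf_of_indicator[OF assms(1), of "{}"] assms(2,3) by (auto simp: zero_assignment_def)

lemma disjoint_pos_varsD:
  assumes "disjoint_pos_vars D" "i < length D" "j < length D"
    and "k \<in> pos_vars (D ! i)" "k \<in> pos_vars (D ! j)"
  shows "i = j"
  using assms unfolding disjoint_pos_vars_def by blast

lemma bs_at_zero_le_length:
  assumes dnf: "dnf_of D f" and f0: "\<not> f zero_assignment"
  shows "bs_at f zero_assignment \<le> length D"
proof -
  have "k \<le> length D" if B: "sensitive_blocks f zero_assignment k B" for k B
  proof -
    have "\<exists>i<length D. pos_vars (D ! i) \<subseteq> B j" if "j < k" for j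
    proof -
      have "f (flip (\<lambda>k. k \<in> {}) (B j))"
        using B that f0 by (auto simp: sensitive_blocks_def zero_assignment_def)
      then show ?thesis
        unfolding flip_indicator dnf_of_indicator[OF dnf] by auto
    qed
    then obtain g where g: "\<And>j. j < k \<Longrightarrow> g j < length D \<and> pos_vars (D ! g j) \<subseteq> B j"
      by metis
    \<comment> \<open>Two blocks assigned the same term would share its nonempty set of unnegated
      variables.\<close>
    have "inj_on g {..<k}"
    proof (rule inj_onI)
      fix i j assume ij: "i \<in> {..<k}" "j \<in> {..<k}" "g i = g j"
      then have "pos_vars (D ! g i) \<subseteq> B i \<inter> B j" "pos_vars (D ! g i) \<noteq> {}"
        using g[of i] g[of j] pos_vars_nonempty[OF dnf f0] by auto
      then show "i = j"
        using B ij unfolding sensitive_blocks_def disjoint_family_on_def by blast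
    qed
    then have "card {..<k} \<le> card {..<length D}"
      by (rule card_inj_on_le) (use g in auto)
    then show ?thesis by simp
  qed
  moreover have "0 \<in> {k. \<exists>B. sensitive_blocks f zero_assignment k B}"
    using sensitive_blocks_0 by blast
  ultimately show ?thesis
    unfolding bs_at_def using finite_sensitive_blocks by (subst Max_le_iff) auto
qed

lemma conflict_out_degree_le_sens:
  fixes f :: "'n::finite boolfun"
  assumes dnf: "dnf_of D f" and f0: "\<not> f zero_assignment" and disj: "disjoint_pos_vars D"
    and i: "i < length D"
  shows "card {j\<in>{..<length D}. neg_vars (D ! i) \<inter> pos_vars (D ! j) \<noteq> {} \<and>
    \<not> is_singleton (pos_vars (D ! j))} \<le> sens f" (is "card ?N \<le> _")
proof -
  let ?x = "\<lambda>k. k \<in> pos_vars (D ! i)"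
  have pn: "pos_vars (D ! i) \<inter> neg_vars (D ! i) = {}"
    using dnf i by (auto simp: dnf_of_def)
  note disj' = disjoint_pos_varsD[OF disj]
  have fx: "f ?x"
    using i pn unfolding dnf_of_indicator[OF dnf] by blast
  obtain g where g: "\<And>j. j \<in> ?N \<Longrightarrow> g j \<in> neg_vars (D ! i) \<inter> pos_vars (D ! j)"
    using bchoice[of ?N "\<lambda>j k. k \<in> neg_vars (D ! i) \<inter> pos_vars (D ! j)"] by blast
  have inj: "inj_on g ?N"
  proof (rule inj_onI)
    fix j l assume "j \<in> ?N" "l \<in> ?N" "g j = g l"
    then show "j = l" using g[of j] g[of l] disj'[of j l "g j"] by auto
  qed
  have "\<not> f (flip ?x {g j})" if j: "j \<in> ?N" for j
  proof
    assume "f (flip ?x {g j})"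
    moreover have "g j \<notin> pos_vars (D ! i)"
      using g[OF j] pn by blast
    ultimately obtain l where l: "l < length D"
      and sub: "pos_vars (D ! l) \<subseteq> insert (g j) (pos_vars (D ! i))"
      and neg: "neg_vars (D ! l) \<inter> insert (g j) (pos_vars (D ! i)) = {}"
      unfolding flip_indicator dnf_of_indicator[OF dnf] by auto
    \<comment> \<open>The flip sets \<open>g j\<close>, a negated variable of term \<open>i\<close>,
      to true. Any other satisfied term has no unnegated variable in common with term
      \<open>i\<close>, so only \<open>g j\<close> is left for it; as \<open>g j\<close> belongs to
      term \<open>j\<close>, that term would have a singleton \<open>pos_vars\<close>.\<close>
    have "l \<noteq> i" using neg g[OF j] by blast
    then have "pos_vars (D ! l) \<subseteq> {g j}"
      using sub disj'[OF l i] by blast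
    then have single: "pos_vars (D ! l) = {g j}"
      using pos_vars_nonempty[OF dnf f0 l] by blast
    then have "l = j" using disj'[OF l, of j "g j"] g[OF j] j by auto
    then show False using single j by simp
  qed
  then have "card (g ` ?N) \<le> sens f"
    using fx by (intro card_sensitive_le_sens[of _ f ?x]) blast
  then show ?thesis using card_image[OF inj] by simp
qed

lemma independent_terms_card_le_sens:
  fixes f :: "'n::finite boolfun"
  assumes dnf: "dnf_of D f" and f0: "\<not> f zero_assignment" and disj: "disjoint_pos_vars D"
    and I: "I \<subseteq> {..<length D}"
    and indep: "\<And>i j. \<lbrakk>i \<in> I; j \<in> I; i \<noteq> j; \<not> is_singleton (pos_vars (D ! j))\<rbrakk> \<Longrightarrow>
      neg_vars (D ! i) \<inter> pos_vars (D ! j) = {}"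
  shows "card I \<le> sens f"
proof -
  note disj' = disjoint_pos_varsD[OF disj]
  have "\<forall>i\<in>{..<length D}. \<exists>k. k \<in> pos_vars (D ! i)"
    using pos_vars_nonempty[OF dnf f0] by blast
  then obtain a where a: "\<And>i. i < length D \<Longrightarrow> a i \<in> pos_vars (D ! i)"
    using bchoice[of "{..<length D}" "\<lambda>i k. k \<in> pos_vars (D ! i)"] by blast
  have inj: "inj_on a I"
    using a disj' I by (intro inj_onI) (metis lessThan_iff subsetD)
  define Y where "Y = (\<Union>i\<in>I. pos_vars (D ! i) - {a i})"
  have aY: "a i \<notin> Y" if "i < length D" for i
    using a[OF that] disj'[OF that] I unfolding Y_def by auto
  \<comment> \<open>Every term, whether in \<open>I\<close> or not, has its variable
    \<open>a i\<close> outside \<open>Y\<close>.\<close>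
  have fY: "\<not> f (\<lambda>k. k \<in> Y)"
    unfolding dnf_of_indicator[OF dnf] using a aY by blast
  have "f (flip (\<lambda>k. k \<in> Y) {a i})" if i: "i \<in> I" for i
  proof -
    have il: "i < length D" using i I by auto
    have pn: "pos_vars (D ! i) \<inter> neg_vars (D ! i) = {}"
      using dnf il by (auto simp: dnf_of_def)
    \<comment> \<open>A singleton contributes nothing to \<open>Y\<close> once \<open>a j\<close> is
      removed; this is why edges into singletons can be left out of the digraph.\<close>
    have "neg_vars (D ! i) \<inter> (pos_vars (D ! j) - {a j}) = {}" if j: "j \<in> I" for j
    proof (cases "i = j \<or> \<not> is_singleton (pos_vars (D ! j))")
      case True
      then show ?thesis using pn indep[OF i j] by blast
    next
      case False
      then have "pos_vars (D ! j) = {a j}"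
        using a[of j] j I by (auto simp: is_singleton_def)
      then show ?thesis by simp
    qed
    then have "neg_vars (D ! i) \<inter> insert (a i) Y = {}"
      using a[OF il] pn unfolding Y_def by blast
    moreover have "pos_vars (D ! i) \<subseteq> insert (a i) Y"
      using i unfolding Y_def by blast
    moreover have "Y - {a i} \<union> ({a i} - Y) = insert (a i) Y"
      using aY[OF il] by blast
    ultimately show ?thesis
      unfolding flip_indicator dnf_of_indicator[OF dnf] using il by auto
  qed
  then have "card (a ` I) \<le> sens f"
    using fY by (intro card_sensitive_le_sens[of _ f "\<lambda>k. k \<in> Y"]) blast
  then show ?thesis using card_image[OF inj] by simp
qed

lemma bs_at_zero_le_sens:
  fixes f :: "'n::finite boolfun"
  assumes dnf: "dnf_of D f" and f0: "\<not> f zero_assignment" and disj: "disjoint_pos_vars D"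
  shows "bs_at f zero_assignment \<le> sens f * (2 * sens f + 1)"
proof -
  let ?R = "\<lambda>i j. neg_vars (D ! i) \<inter> pos_vars (D ! j) \<noteq> {} \<and> \<not> is_singleton (pos_vars (D ! j))"
  obtain I where I: "I \<subseteq> {..<length D}" "\<forall>i\<in>I. \<forall>j\<in>I. i \<noteq> j \<longrightarrow> \<not> ?R i j"
    "card {..<length D} \<le> card I * (2 * sens f + 1)"
    using exists_independent_set[of "{..<length D}" ?R "sens f"]
      conflict_out_degree_le_sens[OF assms] by auto
  have "card I \<le> sens f"
    by (rule independent_terms_card_le_sens[OF assms I(1)]) (use I(2) in blast)
  then have "card I * (2 * sens f + 1) \<le> sens f * (2 * sens f + 1)"
    by (rule mult_le_mono1)
  then show ?thesis
    using bs_at_zero_le_length[OF dnf f0] I(3) by simp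
qed

theorem theorem5:
  fixes f :: "('n::finite \<Rightarrow> bool) \<Rightarrow> bool"
  shows "(block_property f \<longrightarrow> bs0 f \<le> 4 * (sens f)\<^sup>2) \<and>
    (normalized_block_property f \<longrightarrow> bs f \<le> 4 * (sens f)\<^sup>2)"
proof -
  \<comment> \<open>Both sides vanish for sensitivity 0; otherwise \<open>sens f\<close> is at most
    its square.\<close>
  have "sens f * (2 * sens f + 1) \<le> 4 * (sens f)\<^sup>2"
    by (cases "sens f") (auto simp: power2_eq_square)
  then have "bs_at f zero_assignment \<le> 4 * (sens f)\<^sup>2"
    if "compact_dnf_of D f" "disjoint_pos_vars D" for D
    using bs_at_zero_le_sens[of D f] that by (auto simp: compact_dnf_of_def)
  then show ?thesis
    unfolding block_property_def normalized_block_property_def normalized_dnf_of_def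
    by (metis compact_dnf_of_def)
qed

end
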